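(* Let $N\in\mathbb N$, let $\hat\rho_0\in\mathrm{Herm}(N)$ be positive semidefinite of full rank, and let $\tau>0$. For every $\hat\sigma\in\mathrm{Herm}(N)$, $$\operatorname{prox}_{\tau\widehat{\mathrm{QKL}}(\cdot,\hat\rho_0)}(\hat\sigma)=\tau\, g^{-1}\Big(\frac{\hat\sigma}{\tau}+\ln\hat\rho_0-\ln\tau\Big)=\tau\, W\Big(\frac1\tau\exp\Big(\frac{\hat\sigma}{\tau}+\ln\hat\rho_0\Big)\Big).$$
   Context: $\mathrm{Herm}(N)$ is the real vector space of Hermitian $N\times N$ complex matrices with inner product $\langle\hat\sigma,\hat\rho\rangle=\operatorname{tr}(\hat\sigma\hat\rho)$ and norm $\|\hat\rho\|_2=\operatorname{tr}(\hat\rho^2)^{1/2}$. The quantum relative entropy $\widehat{\mathrm{QKL}}(\hat\rho,\hat\rho_0)$ (with $\hat\rho_0$ positive definite) equals $\operatorname{tr}(\hat\rho_0-\hat\rho+\hat\rho\ln\hat\rho-\hat\rho\ln\hat\rho_0)$ if $\hat\rho$ is positive semidefinite (with $0\ln0=0$ in the spectral calculus), and $+\infty$ otherwise. The proximal mapping is $\operatorname{prox}_{\tau\widehat{\mathrm{QKL}}(\cdot,\hat\rho_0)}(\hat\sigma):=\operatorname{argmin}_{\hat\rho\in\mathrm{Herm}(N)}\widehat{\mathrm{QKL}}(\hat\rho,\hat\rho_0)+\frac1{2\tau}\|\hat\rho-\hat\sigma\|_2^2$. The function $g:(0,\infty)\to\mathbb R$, $g(t)=\ln t+t$, is a bijection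 with inverse $g^{-1}(t)=W(e^t)$, where $W$ is the (principal branch of the) Lambert $W$ function; scalar functions are applied to Hermitian matrices by spectral calculus, and the scalar $\ln\tau$ stands for $(\ln\tau)$ times the identity matrix. *)

theory Defs
  imports "HOL-Analysis.Analysis"
begin

definition ctranspose :: "complex^'n^'m \<Rightarrow> complex^'m^'n" where
  "ctranspose A = (\<chi> i j. cnj (A $ j $ i))"

definition Herm :: "(complex^'n^'n) set" where
  "Herm = {A. ctranspose A = A}"

definition unitary_mat :: "complex^'n^'n \<Rightarrow> bool" where
  "unitary_mat U \<longleftrightarrow> ctranspose U ** U = mat 1 \<and> U ** ctranspose U = mat 1"

definition real_diag :: "('n \<Rightarrow> real) \<Rightarrow> complex^'n^'n" where
  "real_diag d = (\<chi> i j. if i = j then complex_of_real (d i) else 0)"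

text \<open>The quadratic form of a Hermitian matrix is real-valued, so \<open>Re\<close> loses nothing here.\<close>

definition psd :: "complex^'n^'n \<Rightarrow> bool" where
  "psd A \<longleftrightarrow> A \<in> Herm \<and> (\<forall>x. 0 \<le> Re (\<Sum>i\<in>UNIV. cnj (x $ i) * (A *v x) $ i))"

text \<open>The norm induced by the inner product \<open>tr (A B)\<close>; meaningful on \<open>Herm\<close>, where
  \<open>tr (A A)\<close> is real and nonnegative.\<close>

definition hs_norm :: "complex^'n^'n \<Rightarrow> real" where
  "hs_norm A = sqrt (Re (trace (A ** A)))"

text \<open>Spectral calculus: \<open>f(U diag(d) U\<^sup>*) = U diag(f(d)) U\<^sup>*\<close>. For Hermitian \<open>A\<close> such a
  diagonalisation exists by the spectral theorem and the result does not depend on its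
  choice, so the description is proper.\<close>

definition spectral_fun :: "(real \<Rightarrow> real) \<Rightarrow> complex^'n^'n \<Rightarrow> complex^'n^'n" where
  "spectral_fun f A =
     (THE B. \<exists>U d. unitary_mat U \<and> A = U ** real_diag d ** ctranspose U \<and>
                   B = U ** real_diag (\<lambda>i. f (d i)) ** ctranspose U)"

text \<open>The term \<open>\<rho> ln \<rho>\<close> is the scalar function \<open>t ln t\<close> applied to \<open>\<rho>\<close>; its value at
  \<open>t = 0\<close> is \<open>0\<close>. The trace is real for Hermitian arguments.\<close>

definition QKL :: "complex^'n^'n \<Rightarrow> complex^'n^'n \<Rightarrow> ereal" where
  "QKL \<rho> \<rho>\<^sub>0 =
     (if psd \<rho>
      then ereal (Re (trace (\<rho>\<^sub>0 - \<rho> + spectral_fun (\<lambda>t. t * ln t) \<rho> - \<rho> ** spectral_fun ln \<rho>\<^sub>0)))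
      else \<infinity>)"

text \<open>\<open>prox \<tau> F \<sigma>\<close> is the set of all minimisers defining the proximal mapping of \<open>\<tau> F\<close>
  at \<open>\<sigma>\<close>.\<close>

definition prox :: "real \<Rightarrow> (complex^'n^'n \<Rightarrow> ereal) \<Rightarrow> complex^'n^'n \<Rightarrow> (complex^'n^'n) set" where
  "prox \<tau> F \<sigma> =
     {\<rho>. is_arg_min (\<lambda>\<rho>. F \<rho> + ereal (1 / (2 * \<tau>) * (hs_norm (\<rho> - \<sigma>))\<^sup>2)) (\<lambda>\<rho>. \<rho> \<in> Herm) \<rho>}"

definition g_fun :: "real \<Rightarrow> real" where
  "g_fun t = ln t + t"

definition g_inv :: "real \<Rightarrow> real" where
  "g_inv = the_inv_into {0<..} g_fun"

text \<open>Principal branch of the Lambert function, meaningful for \<open>x \<ge> - exp (-1)\<close>.\<close>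

definition lambert_W :: "real \<Rightarrow> real" where
  "lambert_W x = (THE w. - 1 \<le> w \<and> w * exp w = x)"

end

theory Submission imports Defs begin

text \<open>Write \<open>\<rho>*\<close> for the claimed minimiser. It satisfies the stationarity equation
  \<open>ln \<rho>* = ln \<rho>\<^sub>0 + (\<sigma> - \<rho>*) / \<tau>\<close>, and expanding the square shows that the objective at a
  positive semidefinite \<open>\<rho>\<close> exceeds its value at \<open>\<rho>*\<close> by exactly
  \<open>QKL \<rho> \<rho>* + \<parallel>\<rho> - \<rho>*\<parallel>\<^sup>2 / (2 \<tau>)\<close>. The first term is nonnegative by Klein's inequality, so
  \<open>\<rho>*\<close> is the unique minimiser. Klein's inequality reduces to the scalar inequality
  \<open>s ln s - s ln t - s + t \<ge> 0\<close>, since for eigenbases \<open>U\<close>, \<open>V\<close> the traces become sums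
  weighted by the doubly stochastic matrix \<open>\<bar>(U\<^sup>* V)\<^sub>i\<^sub>j\<bar>\<^sup>2\<close>.\<close>

section \<open>The Hermitian inner product\<close>

text \<open>The inner product of \<open>complex^'n\<close> is real-valued, and real orthogonality is
  too weak for the columns of a unitary matrix. This form, conjugate-linear in its first argument,
  has that inner product as its real part.\<close>

definition cinner_vec :: "complex^'n \<Rightarrow> complex^'n \<Rightarrow> complex" where
  "cinner_vec x y = (\<Sum>i\<in>UNIV. cnj (x $ i) * y $ i)"

lemma Re_cinner_vec: "Re (cinner_vec x y) = x \<bullet> y"
  by (simp add: cinner_vec_def inner_vec_def inner_complex_def)

lemma cinner_vec_self: "cinner_vec x x = of_real ((norm x)\<^sup>2)"
  unfolding power2_norm_eq_inner cinner_vec_def inner_vec_def of_real_sum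
  by (intro sum.cong refl) (simp add: complex_eq_iff inner_complex_def)

lemma cinner_vec_commute: "cinner_vec y x = cnj (cinner_vec x y)"
  by (simp add: cinner_vec_def mult.commute)

lemma cinner_vec_add_right: "cinner_vec x (y + z) = cinner_vec x y + cinner_vec x z"
  by (simp add: cinner_vec_def sum.distrib algebra_simps)

lemma cinner_vec_diff_right: "cinner_vec x (y - z) = cinner_vec x y - cinner_vec x z"
  by (simp add: cinner_vec_def sum_subtractf algebra_simps)

lemma cinner_vec_smult_right: "cinner_vec x (c *s y) = c * cinner_vec x y"
  by (simp add: cinner_vec_def sum_distrib_left algebra_simps)

lemma cinner_vec_scaleR_right: "cinner_vec x (r *\<^sub>R y) = of_real r * cinner_vec x y"
  by (simp add: cinner_vec_def sum_distrib_left scaleR_conv_of_real[where 'a = complex] algebra_simps)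

lemma cinner_vec_scaleR_left: "cinner_vec (r *\<^sub>R x) y = of_real r * cinner_vec x y"
  by (simp add: cinner_vec_def sum_distrib_left scaleR_conv_of_real[where 'a = complex] algebra_simps)

lemma cinner_vec_sum_right: "cinner_vec x (\<Sum>b\<in>B. f b) = (\<Sum>b\<in>B. cinner_vec x (f b))"
  unfolding cinner_vec_def by (simp add: sum_distrib_left) (rule sum.swap)

lemma cinner_vec_axis: "cinner_vec x (axis i 1) = cnj (x $ i)"
  by (simp add: cinner_vec_def axis_def if_distrib cong: if_cong)

lemma continuous_on_cinner_vec: "continuous_on S (cinner_vec x)"
  unfolding cinner_vec_def by (intro continuous_intros)

lemma HermD: "A \<in> Herm \<Longrightarrow> cnj (A $ i $ j) = A $ j $ i"
  by (auto simp: Herm_def ctranspose_def vec_eq_iff)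

lemma cinner_vec_Herm:
  assumes "A \<in> Herm"
  shows "cinner_vec x (A *v y) = cinner_vec (A *v x) y"
proof -
  have "cinner_vec x (A *v y) = (\<Sum>i\<in>UNIV. \<Sum>j\<in>UNIV. cnj (x $ i) * A $ i $ j * y $ j)"
    by (simp add: cinner_vec_def matrix_vector_mult_def sum_distrib_left mult.assoc)
  also have "\<dots> = (\<Sum>j\<in>UNIV. \<Sum>i\<in>UNIV. cnj (x $ i) * A $ i $ j * y $ j)"
    by (rule sum.swap)
  also have "\<dots> = cinner_vec (A *v x) y"
    by (simp add: cinner_vec_def matrix_vector_mult_def sum_distrib_right sum_distrib_left HermD[OF assms] ac_simps)
  finally show ?thesis .
qed

lemma scaleR_matrix_vector: "A *v (r *\<^sub>R x) = r *\<^sub>R (A *v (x :: complex^'n))"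
  by (simp add: matrix_vector_mult_def vec_eq_iff scaleR_sum_right)

section \<open>The spectral theorem\<close>

text \<open>Rayleigh principle: on the compact unit sphere of \<open>S\<close> the form
  \<open>q\<close> attains a maximum at some \<open>v\<close>. Invariance keeps the residual of the
  eigenvalue equation inside \<open>S\<close>, and moving \<open>v\<close> along it would increase
  the Rayleigh quotient unless the residual vanishes.\<close>

lemma Herm_eigenvector_in_subspace:
  fixes A :: "complex^'n^'n"
  assumes A: "A \<in> Herm" and S: "subspace S" "closed S" and inv: "\<And>x. x \<in> S \<Longrightarrow> A *v x \<in> S"
    and ne: "S \<noteq> {0}"
  obtains v l where "v \<in> S" "norm v = 1" "A *v v = l *\<^sub>R v"
proof -
  define q where "q x = x \<bullet> (A *v x)" for x
  have adj: "x \<bullet> (A *v y) = (A *v x) \<bullet> y" for x y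
    using cinner_vec_Herm[OF A, of x y] by (metis Re_cinner_vec)
  obtain x0 where x0: "x0 \<in> S" "x0 \<noteq> 0"
    using ne S(1) subspace_0 by blast
  have "compact (S \<inter> sphere 0 1)"
    using S(2) by (intro closed_Int_compact) auto
  moreover have "x0 /\<^sub>R norm x0 \<in> S \<inter> sphere 0 1"
    using x0 S(1) by (auto intro: subspace_scale)
  moreover have "continuous_on (S \<inter> sphere 0 1) q"
    unfolding q_def matrix_vector_mult_def by (intro continuous_intros)
  ultimately obtain v where v: "v \<in> S" "norm v = 1"
    and max: "\<And>x. x \<in> S \<inter> sphere 0 1 \<Longrightarrow> q x \<le> q v"
    using continuous_attains_sup[of "S \<inter> sphere 0 1" q] by (metis IntD1 IntD2 empty_iff mem_sphere_0)
  define l where "l = q v"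
  have bound: "q x \<le> l * (norm x)\<^sup>2" if "x \<in> S" for x
  proof (cases "x = 0")
    case False
    have "q (x /\<^sub>R norm x) \<le> l"
      unfolding l_def using False that S(1) by (intro max) (auto intro: subspace_scale)
    moreover have "q (x /\<^sub>R norm x) = q x / (norm x)\<^sup>2"
      by (simp add: q_def scaleR_matrix_vector power2_eq_square divide_inverse)
    ultimately show ?thesis using False by (simp add: divide_le_eq)
  qed (simp add: q_def)
  define w where "w = l *\<^sub>R v - A *v v"
  have wS: "w \<in> S"
    unfolding w_def using v inv S(1) by (intro subspace_diff subspace_scale)
  \<comment> \<open>\<open>c\<close> is the quadratic coefficient in \<open>t\<close> of \<open>l *
    (norm (v + t *\<^sub>R w))\<^sup>2 - q (v + t *\<^sub>R w)\<close>; by the choice of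
    \<open>w\<close> the linear coefficient is twice the squared norm of \<open>w\<close>.\<close>
  define c where "c = l * (norm w)\<^sup>2 - q w"
  have pos: "0 \<le> 2 * t * (norm w)\<^sup>2 + t\<^sup>2 * c" for t :: real
  proof -
    have "v + t *\<^sub>R w \<in> S"
      using v wS S(1) by (intro subspace_add subspace_scale)
    from bound[OF this] have "q (v + t *\<^sub>R w) \<le> l * (norm (v + t *\<^sub>R w))\<^sup>2" .
    moreover have "q (v + t *\<^sub>R w) = l + 2 * t * (w \<bullet> (A *v v)) + t\<^sup>2 * q w"
      unfolding l_def q_def
      by (simp add: matrix_vector_right_distrib scaleR_matrix_vector inner_add_left inner_add_right
          adj[of v w] inner_commute[of _ w] algebra_simps power2_eq_square)
    moreover have "(norm (v + t *\<^sub>R w))\<^sup>2 = 1 + 2 * t * (w \<bullet> v) + t\<^sup>2 * (norm w)\<^sup>2"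
    proof -
      have "v \<bullet> v = 1" using v(2) by (simp add: norm_eq_1)
      thus ?thesis
        unfolding power2_norm_eq_inner
        by (simp add: inner_add_left inner_add_right inner_commute[of v w] algebra_simps power2_eq_square)
    qed
    moreover have "2 * t * (norm w)\<^sup>2 = 2 * t * (l * (w \<bullet> v) - w \<bullet> (A *v v))"
      unfolding power2_norm_eq_inner by (subst (2) w_def) (simp add: inner_diff_right)
    ultimately show ?thesis
      unfolding c_def by (simp add: algebra_simps)
  qed
  have "w = 0"
  proof (rule ccontr)
    assume "w \<noteq> 0"
    hence N: "(norm w)\<^sup>2 > 0" by simp
    \<comment> \<open>A small negative \<open>t\<close> lets the linear term dominate: here
      \<open>t * c\<close> is at least minus the squared norm of \<open>w\<close>. The summand 1
      keeps the denominator positive when \<open>c\<close> is 0.\<close>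
    define t where "t = - (norm w)\<^sup>2 / (\<bar>c\<bar> + 1)"
    have t: "t < 0" "t * (\<bar>c\<bar> + 1) = - (norm w)\<^sup>2"
      using N by (auto simp: t_def divide_less_0_iff field_simps)
    have "t * c \<ge> t * (\<bar>c\<bar> + 1)"
      using t(1) by (intro mult_left_mono_neg) auto
    hence "2 * (norm w)\<^sup>2 + t * c > 0" using t N by linarith
    hence "t * (2 * (norm w)\<^sup>2 + t * c) < 0"
      using t(1) by (simp add: mult_neg_pos)
    moreover have "t * (2 * (norm w)\<^sup>2 + t * c) = 2 * t * (norm w)\<^sup>2 + t\<^sup>2 * c"
      by (simp add: algebra_simps power2_eq_square)
    ultimately show False using pos[of t] by linarith
  qed
  hence "A *v v = l *\<^sub>R v" by (simp add: w_def)
  thus ?thesis using that v by blast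
qed

text \<open>Take an orthonormal set of eigenvectors of greatest cardinality. Its orthogonal
  complement is invariant because \<open>A\<close> is Hermitian, so a nonzero complement would
  contain a further eigenvector.\<close>

lemma Herm_orthonormal_eigenbasis:
  fixes A :: "complex^'n^'n"
  assumes A: "A \<in> Herm"
  obtains B where "finite B" "card B = CARD('n)"
    "\<And>b c. b \<in> B \<Longrightarrow> c \<in> B \<Longrightarrow> cinner_vec b c = (if b = c then 1 else 0)"
    "\<And>b. b \<in> B \<Longrightarrow> \<exists>l::real. A *v b = l *\<^sub>R b"
proof -
  define P where "P B \<longleftrightarrow> finite B \<and>
    (\<forall>b\<in>B. \<forall>c\<in>B. cinner_vec b c = (if b = c then 1 else 0)) \<and>
    (\<forall>b\<in>B. \<exists>l::real. A *v b = l *\<^sub>R b)" for B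
  \<comment> \<open>The real dimension is twice \<open>CARD('n)\<close>, but any bound suffices for
    a greatest cardinality to exist; the exact count comes from Parseval below.\<close>
  have bnd: "card B \<le> DIM(complex^'n)" if "P B" for B
  proof -
    have "pairwise orthogonal B"
    proof (rule pairwiseI)
      fix b c assume "b \<in> B" "c \<in> B" "b \<noteq> c"
      hence "cinner_vec b c = 0" using that by (auto simp: P_def)
      thus "orthogonal b c" using Re_cinner_vec[of b c] by (simp add: orthogonal_def)
    qed
    moreover have "0 \<notin> B"
    proof
      assume "0 \<in> B"
      hence "cinner_vec (0 :: complex^'n) 0 = 1" using that by (simp add: P_def)
      thus False by (simp add: cinner_vec_self)
    qed
    ultimately have "independent B" by (rule pairwise_orthogonal_independent)
    thus ?thesis by (metis independent_bound)
  qed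
  have "P {}" by (simp add: P_def)
  obtain B where PB: "P B" and max: "\<And>C. P C \<Longrightarrow> card C \<le> card B"
    using ex_has_greatest_nat[of P "{}" card "DIM(complex^'n) + 1"] \<open>P {}\<close> bnd
    by (metis Suc_eq_plus1 less_Suc_eq_le)
  have fin: "finite B" using PB by (simp add: P_def)
  have orth: "cinner_vec b c = (if b = c then 1 else 0)" if "b \<in> B" "c \<in> B" for b c
    using PB that by (simp add: P_def)
  have eig: "\<exists>l::real. A *v b = l *\<^sub>R b" if "b \<in> B" for b
    using PB that by (simp add: P_def)
  \<comment> \<open>The complement is taken with respect to the complex form, so that its vanishing
    yields an expansion with complex coefficients.\<close>
  define S where "S = {x. \<forall>b\<in>B. cinner_vec b x = 0}"
  have "S = {0}"
  proof (rule ccontr)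
    assume ne: "S \<noteq> {0}"
    have "subspace S"
      by (rule subspaceI)
         (auto simp: S_def cinner_vec_add_right cinner_vec_scaleR_right, simp add: cinner_vec_def)
    moreover have "closed S"
    proof -
      have "S = (\<Inter>b\<in>B. {x. cinner_vec b x = 0})" by (auto simp: S_def)
      thus ?thesis by (auto intro!: closed_Collect_eq continuous_on_cinner_vec)
    qed
    moreover have "A *v x \<in> S" if "x \<in> S" for x
    proof -
      have "cinner_vec b (A *v x) = 0" if "b \<in> B" for b
      proof -
        obtain l :: real where "A *v b = l *\<^sub>R b" using eig \<open>b \<in> B\<close> by blast
        thus ?thesis
          using \<open>x \<in> S\<close> that by (simp add: cinner_vec_Herm[OF A] cinner_vec_scaleR_left S_def)
      qed
      thus ?thesis by (simp add: S_def)
    qed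
    ultimately obtain v l where v: "v \<in> S" "norm v = 1" "A *v v = l *\<^sub>R v"
      using Herm_eigenvector_in_subspace[OF A _ _ _ ne] by blast
    have vv: "cinner_vec v v = 1" using v(2) by (simp add: cinner_vec_self)
    have bv: "cinner_vec b v = 0" "cinner_vec v b = 0" if "b \<in> B" for b
      using v(1) that cinner_vec_commute[of v b] by (auto simp: S_def)
    have "v \<notin> B" using vv bv by fastforce
    moreover have "P (insert v B)"
      unfolding P_def using fin orth eig vv bv v(3) \<open>v \<notin> B\<close> by auto
    ultimately show False using max[of "insert v B"] fin by simp
  qed
  have expand: "x = (\<Sum>b\<in>B. cinner_vec b x *s b)" for x
  proof -
    have "x - (\<Sum>b\<in>B. cinner_vec b x *s b) \<in> S"
      by (auto simp: S_def cinner_vec_diff_right cinner_vec_sum_right cinner_vec_smult_right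
          orth fin if_distrib sum.delta cong: if_cong)
    thus ?thesis using \<open>S = {0}\<close> by auto
  qed
  \<comment> \<open>Parseval gives \<open>(\<Sum>b\<in>B. \<bar>b\<^sub>i\<bar>\<^sup>2) = 1\<close> for every \<open>i\<close>; summing over \<open>i\<close> counts \<open>B\<close>.\<close>
  have row: "(\<Sum>b\<in>B. cnj (b $ i) * b $ i) = 1" for i
  proof -
    have "1 = axis i (1::complex) $ i" by (simp add: axis_def)
    also have "\<dots> = (\<Sum>b\<in>B. cnj (b $ i) * b $ i)"
      by (subst expand) (simp add: cinner_vec_axis)
    finally show ?thesis by simp
  qed
  have "of_nat (card B) = (\<Sum>b\<in>B. cinner_vec b b)"
    by (simp add: orth)
  also have "\<dots> = (\<Sum>i\<in>UNIV. \<Sum>b\<in>B. cnj (b $ i) * b $ i)"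
    unfolding cinner_vec_def by (rule sum.swap)
  also have "\<dots> = of_nat CARD('n)" by (simp add: row)
  finally have "card B = CARD('n)" using of_nat_eq_iff[where 'a = complex] by blast
  thus ?thesis using that fin orth eig by blast
qed

lemma unitary_matI:
  assumes "ctranspose U ** U = mat 1" shows "unitary_mat U"
  using assms matrix_left_right_inverse[of U "ctranspose U"] by (simp add: unitary_mat_def)

lemma spectral_theorem:
  fixes A :: "complex^'n^'n"
  assumes A: "A \<in> Herm"
  obtains U d where "unitary_mat U" "A = U ** real_diag d ** ctranspose U"
proof -
  obtain B where B: "finite B" "card B = CARD('n)"
    and orth: "\<And>b c. b \<in> B \<Longrightarrow> c \<in> B \<Longrightarrow> cinner_vec b c = (if b = c then 1 else 0)"
    and eig: "\<And>b. b \<in> B \<Longrightarrow> \<exists>l::real. A *v b = l *\<^sub>R b"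
    using Herm_orthonormal_eigenbasis[OF A] by metis
  \<comment> \<open>The cardinality of the basis lets the index type \<open>'n\<close> enumerate it,
    so its vectors become the columns of a square matrix.\<close>
  obtain u where u: "bij_betw u (UNIV :: 'n set) B"
    using B finite_same_card_bij[of "UNIV :: 'n set" B] by auto
  have uB: "u i \<in> B" for i using u by (auto simp: bij_betw_def)
  have uinj: "u i = u j \<longleftrightarrow> i = j" for i j
    using u by (auto simp: bij_betw_def inj_on_def)
  obtain d where d: "\<And>i. A *v u i = d i *\<^sub>R u i"
    using eig[OF uB] by metis
  define U :: "complex^'n^'n" where "U = (\<chi> i j. u j $ i)"
  have "(ctranspose U ** U) $ i $ j = mat 1 $ i $ j" for i j
    using orth[OF uB uB, of i j]
    by (simp add: matrix_matrix_mult_def ctranspose_def U_def cinner_vec_def mat_def uinj)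
  hence U: "unitary_mat U" by (intro unitary_matI) (simp add: vec_eq_iff)
  have "(A ** U) $ i $ j = (U ** real_diag d) $ i $ j" for i j
    using arg_cong[OF d, of "\<lambda>x. x $ i" j]
    by (simp add: matrix_matrix_mult_def matrix_vector_mult_def U_def real_diag_def
        if_distrib scaleR_conv_of_real[where 'a = complex] mult.commute cong: if_cong)
  hence "A ** U = U ** real_diag d" by (simp add: vec_eq_iff)
  hence "A ** (U ** ctranspose U) = U ** real_diag d ** ctranspose U"
    by (simp add: matrix_mul_assoc)
  hence "A = U ** real_diag d ** ctranspose U"
    using U by (simp add: unitary_mat_def)
  thus ?thesis using that U by blast
qed

section \<open>Spectral calculus\<close>

lemma ctranspose_mult: "ctranspose (A ** B) = ctranspose B ** ctranspose A"
  by (simp add: ctranspose_def matrix_matrix_mult_def vec_eq_iff mult.commute)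

lemma ctranspose_ctranspose [simp]: "ctranspose (ctranspose A) = A"
  by (simp add: ctranspose_def vec_eq_iff)

lemma real_diag_mult_left: "(real_diag d ** A) $ i $ j = of_real (d i) * A $ i $ j"
  by (simp add: matrix_matrix_mult_def real_diag_def if_distrib if_distribR cong: if_cong)

lemma real_diag_mult_right: "(A ** real_diag d) $ i $ j = A $ i $ j * of_real (d j)"
  by (simp add: matrix_matrix_mult_def real_diag_def if_distrib cong: if_cong)

lemma real_diag_conj_in_Herm: "U ** real_diag d ** ctranspose U \<in> Herm"
proof -
  have "ctranspose (real_diag d) = real_diag d"
    by (simp add: ctranspose_def real_diag_def vec_eq_iff)
  thus ?thesis by (simp add: Herm_def ctranspose_mult matrix_mul_assoc)
qed

text \<open>This makes the spectral calculus well defined. The matrix \<open>W\<close> intertwines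
  the two diagonals, so an entry of \<open>W\<close> can be nonzero only where the eigenvalues
  \<open>d i\<close> and \<open>e j\<close> agree; hence \<open>W\<close> also intertwines their
  images under \<open>f\<close>.\<close>

lemma real_diag_conj_fun_cong:
  fixes U V :: "complex^'n^'n"
  assumes U: "unitary_mat U" and V: "unitary_mat V"
    and eq: "U ** real_diag d ** ctranspose U = V ** real_diag e ** ctranspose V"
  shows "U ** real_diag (\<lambda>i. f (d i)) ** ctranspose U = V ** real_diag (\<lambda>i. f (e i)) ** ctranspose V"
proof -
  define W where "W = ctranspose U ** V"
  have "ctranspose U ** (U ** real_diag d ** ctranspose U) ** V =
        ctranspose U ** (V ** real_diag e ** ctranspose V) ** V"
    by (simp add: eq)
  also have "\<dots> = ctranspose U ** V ** real_diag e ** (ctranspose V ** V)"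
    by (simp add: matrix_mul_assoc)
  also have "ctranspose U ** (U ** real_diag d ** ctranspose U) ** V =
        (ctranspose U ** U) ** real_diag d ** (ctranspose U ** V)"
    by (simp add: matrix_mul_assoc)
  finally have "real_diag d ** W = W ** real_diag e"
    using U V by (simp add: W_def unitary_mat_def)
  hence *: "of_real (d i) * W $ i $ j = W $ i $ j * of_real (e j)" for i j
    by (metis real_diag_mult_left real_diag_mult_right)
  have "W $ i $ j = 0 \<or> d i = e j" for i j
    using *[of i j] by (auto simp: mult.commute)
  hence "of_real (f (d i)) * W $ i $ j = W $ i $ j * of_real (f (e j))" for i j
    by (metis mult.commute mult_zero_left)
  hence "real_diag (\<lambda>i. f (d i)) ** W = W ** real_diag (\<lambda>i. f (e i))"
    by (simp add: vec_eq_iff real_diag_mult_left real_diag_mult_right)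
  hence "U ** (real_diag (\<lambda>i. f (d i)) ** W) ** ctranspose V =
         U ** (W ** real_diag (\<lambda>i. f (e i))) ** ctranspose V"
    by simp
  hence "U ** real_diag (\<lambda>i. f (d i)) ** ctranspose U ** (V ** ctranspose V) =
         (U ** ctranspose U) ** V ** real_diag (\<lambda>i. f (e i)) ** ctranspose V"
    by (simp add: W_def matrix_mul_assoc)
  thus ?thesis using U V by (simp add: unitary_mat_def)
qed

lemma spectral_fun_real_diag_conj:
  assumes "unitary_mat U"
  shows "spectral_fun f (U ** real_diag d ** ctranspose U) =
         U ** real_diag (\<lambda>i. f (d i)) ** ctranspose U"
  unfolding spectral_fun_def
proof (rule the_equality)
  show "\<exists>V e. unitary_mat V \<and> U ** real_diag d ** ctranspose U = V ** real_diag e ** ctranspose V \<and>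
      U ** real_diag (\<lambda>i. f (d i)) ** ctranspose U = V ** real_diag (\<lambda>i. f (e i)) ** ctranspose V"
    using assms by blast
qed (use assms real_diag_conj_fun_cong in metis)

lemma spectral_fun_in_Herm: "A \<in> Herm \<Longrightarrow> spectral_fun f A \<in> Herm"
  by (metis spectral_theorem spectral_fun_real_diag_conj real_diag_conj_in_Herm)

section \<open>Arithmetic of matrices with a common eigenbasis\<close>

lemma matrix_add_rdistrib: "(A + B) ** C = A ** C + B ** C"
  by (simp add: matrix_matrix_mult_def vec_eq_iff distrib_right sum.distrib)

lemma real_diag_conj_add:
  "U ** real_diag d ** ctranspose U + U ** real_diag e ** ctranspose U =
   U ** real_diag (\<lambda>i. d i + e i) ** ctranspose U"
proof -
  have "real_diag (\<lambda>i. d i + e i) = real_diag d + (real_diag e :: complex^_^_)"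
    by (simp add: real_diag_def vec_eq_iff)
  thus ?thesis by (simp add: matrix_add_ldistrib matrix_add_rdistrib)
qed

lemma real_diag_conj_scaleR:
  "r *\<^sub>R (U ** real_diag d ** ctranspose U) = U ** real_diag (\<lambda>i. r * d i) ** ctranspose U"
proof -
  have "real_diag (\<lambda>i. r * d i) = r *\<^sub>R (real_diag d :: complex^_^_)"
    by (simp add: real_diag_def vec_eq_iff scaleR_conv_of_real[where 'a = complex])
  thus ?thesis by (simp add: scalar_matrix_assoc matrix_scalar_ac)
qed

lemma mat_eq_real_diag_conj:
  assumes "unitary_mat U"
  shows "mat (complex_of_real c) = U ** real_diag (\<lambda>_. c) ** ctranspose U"
proof -
  have "real_diag (\<lambda>_. c) = c *\<^sub>R (mat 1 :: complex^_^_)"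
    by (simp add: real_diag_def mat_def vec_eq_iff scaleR_conv_of_real[where 'a = complex])
  moreover have "mat (complex_of_real c) = c *\<^sub>R (mat 1 :: complex^_^_)"
    by (simp add: mat_def vec_eq_iff scaleR_conv_of_real[where 'a = complex])
  ultimately show ?thesis
    using assms unfolding unitary_mat_def
    by (metis matrix_scalar_ac matrix_mul_rid scalar_matrix_assoc)
qed

lemma real_diag_conj_mult:
  assumes "unitary_mat U"
  shows "(U ** real_diag d ** ctranspose U) ** (U ** real_diag e ** ctranspose U) =
         U ** real_diag (\<lambda>i. d i * e i) ** ctranspose U"
proof -
  have "(U ** real_diag d ** ctranspose U) ** (U ** real_diag e ** ctranspose U) =
        U ** (real_diag d ** (ctranspose U ** U) ** real_diag e) ** ctranspose U"
    by (simp add: matrix_mul_assoc)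
  also have "real_diag d ** (ctranspose U ** U) ** real_diag e = real_diag (\<lambda>i. d i * e i)"
  proof -
    have "(real_diag d ** real_diag e) $ i $ j = real_diag (\<lambda>i. d i * e i) $ i $ j" for i j
      unfolding real_diag_mult_left by (simp add: real_diag_def)
    thus ?thesis using assms unfolding unitary_mat_def by (metis matrix_mul_rid vec_eq_iff)
  qed
  finally show ?thesis .
qed

text \<open>In the coordinates \<open>ctranspose U *v x\<close> the quadratic form is a sum of
  squared moduli weighted by \<open>d\<close>. The columns of \<open>U\<close> isolate the
  individual weights.\<close>

lemma psd_real_diag_conj_iff:
  assumes U: "unitary_mat U"
  shows "psd (U ** real_diag d ** ctranspose U) \<longleftrightarrow> (\<forall>i. 0 \<le> d i)"
proof -
  let ?A = "U ** real_diag d ** ctranspose U"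
  have form: "Re (\<Sum>i\<in>UNIV. cnj (x $ i) * (?A *v x) $ i) =
      (\<Sum>k\<in>UNIV. d k * (norm ((ctranspose U *v x) $ k))\<^sup>2)" for x
  proof -
    define y where "y = ctranspose U *v x"
    have "(\<Sum>i\<in>UNIV. cnj (x $ i) * (?A *v x) $ i) =
          (\<Sum>i\<in>UNIV. cnj (x $ i) * (U *v (real_diag d *v y)) $ i)"
      by (simp add: y_def matrix_vector_mul_assoc matrix_mul_assoc)
    also have "\<dots> = (\<Sum>i\<in>UNIV. \<Sum>k\<in>UNIV. cnj (x $ i) * U $ i $ k * (real_diag d *v y) $ k)"
      by (simp add: matrix_vector_mult_def[of U] sum_distrib_left mult.assoc)
    also have "\<dots> = (\<Sum>k\<in>UNIV. \<Sum>i\<in>UNIV. cnj (x $ i) * U $ i $ k * (real_diag d *v y) $ k)"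
      by (rule sum.swap)
    also have "\<dots> = (\<Sum>k\<in>UNIV. cnj (y $ k) * (real_diag d *v y) $ k)"
    proof -
      have "cnj (y $ k) = (\<Sum>i\<in>UNIV. cnj (x $ i) * U $ i $ k)" for k
        by (simp add: y_def matrix_vector_mult_def ctranspose_def mult.commute)
      thus ?thesis by (simp add: sum_distrib_right)
    qed
    also have "\<dots> = (\<Sum>k\<in>UNIV. of_real (d k * (norm (y $ k))\<^sup>2))"
      unfolding of_real_mult complex_norm_square
      by (simp add: matrix_vector_mult_def real_diag_def if_distrib if_distribR mult_ac cong: if_cong)
    finally show ?thesis by (simp add: y_def)
  qed
  show ?thesis
  proof
    assume psd: "psd ?A"
    show "\<forall>i. 0 \<le> d i"
    proof
      fix i
      have "ctranspose U *v (U *v axis i 1) = axis i 1"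
        using U by (simp add: matrix_vector_mul_assoc unitary_mat_def)
      moreover have "0 \<le> Re (\<Sum>j\<in>UNIV. cnj ((U *v axis i 1) $ j) * (?A *v (U *v axis i 1)) $ j)"
        using psd unfolding psd_def by blast
      ultimately have "0 \<le> (\<Sum>k\<in>UNIV. d k * (norm (axis i (1::complex) $ k))\<^sup>2)"
        unfolding form by simp
      also have "(\<lambda>k. d k * (norm (axis i (1::complex) $ k))\<^sup>2) = (\<lambda>k. if k = i then d i else 0)"
        by (auto simp: axis_def)
      also have "(\<Sum>k\<in>UNIV. if k = i then d i else 0) = d i" by simp
      finally show "0 \<le> d i" .
    qed
  next
    assume "\<forall>i. 0 \<le> d i"
    thus "psd ?A"
      unfolding psd_def form using real_diag_conj_in_Herm by (auto intro!: sum_nonneg)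
  qed
qed

section \<open>Traces and Klein's inequality\<close>

text \<open>Cyclicity of the trace moves both bases into the single overlap matrix \<open>W\<close>,
  whose squared moduli become the weights of a sum over pairs of eigenvalues.\<close>

lemma Re_trace_real_diag_conj_mult:
  fixes U V :: "complex^'n^'n"
  shows "Re (trace ((U ** real_diag d ** ctranspose U) ** (V ** real_diag e ** ctranspose V))) =
    (\<Sum>i\<in>UNIV. \<Sum>j\<in>UNIV. (norm ((ctranspose U ** V) $ i $ j))\<^sup>2 * (d i * e j))"
proof -
  define W where "W = ctranspose U ** V"
  have "trace ((U ** real_diag d ** ctranspose U) ** (V ** real_diag e ** ctranspose V)) =
        trace (U ** (real_diag d ** W ** real_diag e ** ctranspose V))"
    by (simp add: W_def matrix_mul_assoc)
  also have "\<dots> = trace ((real_diag d ** W ** real_diag e ** ctranspose V) ** U)"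
    by (rule trace_mul_sym)
  also have "\<dots> = trace ((real_diag d ** W ** real_diag e) ** ctranspose W)"
    by (simp add: W_def matrix_mul_assoc ctranspose_mult)
  also have "\<dots> = (\<Sum>i\<in>UNIV. \<Sum>j\<in>UNIV. of_real ((norm (W $ i $ j))\<^sup>2 * (d i * e j)))"
    unfolding trace_def matrix_matrix_mult_def[of _ "ctranspose W"]
    unfolding of_real_mult complex_norm_square
    by (simp add: real_diag_mult_left real_diag_mult_right ctranspose_def mult_ac)
  finally show ?thesis by (simp add: W_def)
qed

text \<open>The bound \<open>ln x \<le> x - 1\<close> at \<open>x = t / s\<close>, multiplied by
  \<open>s\<close>. For \<open>s = 0\<close> both logarithmic terms vanish and \<open>t\<close>
  remains.\<close>

lemma Klein_scalar:
  fixes s t :: real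
  assumes "0 \<le> s" "0 < t"
  shows "0 \<le> s * ln s - s * ln t - s + t"
proof (cases "s = 0")
  case False
  hence s: "0 < s" using assms by simp
  have "s * ln (t / s) \<le> s * (t / s - 1)"
    using s assms by (intro mult_left_mono ln_le_minus_one) auto
  thus ?thesis using s assms by (simp add: ln_div right_diff_distrib)
qed (use assms in simp)

lemma Klein_inequality:
  fixes U :: "complex^'n^'n"
  assumes U: "unitary_mat U" and t: "\<And>i. 0 < t i" and \<rho>: "psd \<rho>"
  defines "R \<equiv> U ** real_diag t ** ctranspose U"
  shows "0 \<le> Re (trace (spectral_fun (\<lambda>s. s * ln s) \<rho>)) - Re (trace (\<rho> ** spectral_fun ln R))
            - Re (trace \<rho>) + Re (trace R)"
proof -
  obtain V s where V: "unitary_mat V" and \<rho>_eq: "\<rho> = V ** real_diag s ** ctranspose V"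
    using spectral_theorem \<rho> unfolding psd_def by blast
  have s: "0 \<le> s i" for i using \<rho> psd_real_diag_conj_iff[OF V] \<rho>_eq by blast
  note tr = Re_trace_real_diag_conj_mult[of V _ U]
  \<comment> \<open>The identity is diagonal in every orthonormal basis. Pairing each single trace
    with the identity written in the other basis turns it into a double sum with the same weights,
    which absorbs the row and column sums of those weights.\<close>
  note one = mat_eq_real_diag_conj[of _ 1, simplified]
  have 1: "Re (trace (V ** real_diag a ** ctranspose V)) =
      (\<Sum>i\<in>UNIV. \<Sum>j\<in>UNIV. (norm ((ctranspose V ** U) $ i $ j))\<^sup>2 * a i)" for a
    using tr[of a "\<lambda>_. 1"] one[OF U] by (metis (no_types, lifting) matrix_mul_rid mult.right_neutral sum.cong)
  have 2: "Re (trace R) =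
      (\<Sum>i\<in>UNIV. \<Sum>j\<in>UNIV. (norm ((ctranspose V ** U) $ i $ j))\<^sup>2 * t j)"
    using tr[of "\<lambda>_. 1" t] one[OF V] unfolding R_def
    by (metis (no_types, lifting) matrix_mul_lid mult.left_neutral sum.cong)
  have "Re (trace (spectral_fun (\<lambda>s. s * ln s) \<rho>)) - Re (trace (\<rho> ** spectral_fun ln R))
            - Re (trace \<rho>) + Re (trace R) =
     (\<Sum>i\<in>UNIV. \<Sum>j\<in>UNIV. (norm ((ctranspose V ** U) $ i $ j))\<^sup>2 *
        (s i * ln (s i) - s i * ln (t j) - s i + t j))"
    unfolding 2 unfolding R_def \<rho>_eq spectral_fun_real_diag_conj[OF U] spectral_fun_real_diag_conj[OF V] tr 1
    by (simp add: sum_subtractf sum.distrib algebra_simps)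
  also have "\<dots> \<ge> 0"
    using s t by (intro sum_nonneg mult_nonneg_nonneg Klein_scalar) auto
  finally show ?thesis .
qed

text \<open>For Hermitian \<open>A\<close> the product of the entries at \<open>(i, j)\<close> and
  \<open>(j, i)\<close> is a squared modulus. Hence \<open>hs_norm\<close> is the Frobenius norm on
  \<open>Herm\<close>, which gives its definiteness.\<close>

lemma Re_trace_square_Herm:
  assumes "A \<in> Herm"
  shows "Re (trace (A ** A)) = (\<Sum>i\<in>UNIV. \<Sum>j\<in>UNIV. (norm (A $ i $ j))\<^sup>2)"
proof -
  have "trace (A ** A) = (\<Sum>i\<in>UNIV. \<Sum>j\<in>UNIV. of_real ((norm (A $ i $ j))\<^sup>2))"
    by (simp only: trace_def matrix_matrix_mult_def complex_norm_square HermD[OF assms] vec_lambda_beta)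
  thus ?thesis by simp
qed

lemma hs_norm_square: "A \<in> Herm \<Longrightarrow> (hs_norm A)\<^sup>2 = Re (trace (A ** A))"
  unfolding hs_norm_def by (simp add: Re_trace_square_Herm sum_nonneg)

lemma hs_norm_eq_0: "A \<in> Herm \<Longrightarrow> hs_norm A = 0 \<Longrightarrow> A = 0"
  unfolding hs_norm_def
  by (auto simp: Re_trace_square_Herm sum_nonneg_eq_0_iff sum_nonneg vec_eq_iff)

section \<open>Closure of \<open>Herm\<close> and real bilinearity of the trace form\<close>

lemma Herm_diff: "A \<in> Herm \<Longrightarrow> B \<in> Herm \<Longrightarrow> A - B \<in> Herm"
  by (auto simp: Herm_def ctranspose_def vec_eq_iff)

lemma Herm_add: "A \<in> Herm \<Longrightarrow> B \<in> Herm \<Longrightarrow> A + B \<in> Herm"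
  by (auto simp: Herm_def ctranspose_def vec_eq_iff)

lemma Herm_scaleR: "A \<in> Herm \<Longrightarrow> r *\<^sub>R A \<in> Herm"
  by (auto simp: Herm_def ctranspose_def vec_eq_iff)

lemma Re_trace_mult_add_left: "Re (trace ((A + B) ** C)) = Re (trace (A ** C)) + Re (trace (B ** C))"
  for A B C :: "complex^'n^'n"
  by (simp add: matrix_add_rdistrib trace_add)

lemma Re_trace_mult_diff_left: "Re (trace ((A - B) ** C)) = Re (trace (A ** C)) - Re (trace (B ** C))"
  for A B C :: "complex^'n^'n"
  using Re_trace_mult_add_left[of "A - B" B C] by simp

lemma Re_trace_mult_scaleR_left: "Re (trace ((r *\<^sub>R A) ** C)) = r * Re (trace (A ** C))"
  for A C :: "complex^'n^'n"
  by (simp add: scalar_matrix_assoc[symmetric] trace_def sum_distrib_left)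

lemma Re_trace_mult_add_right: "Re (trace (C ** (A + B))) = Re (trace (C ** A)) + Re (trace (C ** B))"
  for A B C :: "complex^'n^'n"
  by (metis Re_trace_mult_add_left trace_mul_sym)

lemma Re_trace_mult_diff_right: "Re (trace (C ** (A - B))) = Re (trace (C ** A)) - Re (trace (C ** B))"
  for A B C :: "complex^'n^'n"
  by (metis Re_trace_mult_diff_left trace_mul_sym)

lemma Re_trace_mult_scaleR_right: "Re (trace (C ** (r *\<^sub>R A))) = r * Re (trace (C ** A))"
  for A C :: "complex^'n^'n"
  by (metis Re_trace_mult_scaleR_left trace_mul_sym)

section \<open>The scalar functions\<close>

lemma g_fun_strict_mono: "0 < s \<Longrightarrow> s < t \<Longrightarrow> g_fun s < g_fun t"
  by (simp add: g_fun_def add_strict_mono)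

lemma g_fun_inj_on: "inj_on g_fun {0<..}"
  by (rule linorder_inj_onI') (use g_fun_strict_mono in fastforce)

lemma g_fun_surj: "\<exists>t>0. g_fun t = y"
proof -
  \<comment> \<open>Left end for the intermediate value theorem: \<open>ln a \<le> y - 1\<close> and
    \<open>a \<le> 1\<close> give \<open>g_fun a \<le> y\<close>. On the right,
    \<open>max y 1\<close> has nonnegative logarithm.\<close>
  define a where "a = exp (min y 0 - 1)"
  have a: "0 < a" "a \<le> 1" "ln a = min y 0 - 1" by (auto simp: a_def)
  have "g_fun a \<le> y" using a by (auto simp: g_fun_def min_def split: if_splits)
  moreover have "y \<le> g_fun (max y 1)" by (auto simp: g_fun_def max_def)
  moreover have "continuous_on {a..max y 1} g_fun"
    unfolding g_fun_def using a by (intro continuous_intros) auto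
  ultimately obtain t where "a \<le> t" "t \<le> max y 1" "g_fun t = y"
    using IVT'[of g_fun a y "max y 1"] a by (auto simp: le_max_iff_disj)
  thus ?thesis using a by (intro exI[of _ t]) auto
qed

lemma g_inv_pos: "0 < g_inv y" and g_fun_g_inv: "ln (g_inv y) + g_inv y = y"
proof -
  have y: "y \<in> g_fun ` {0<..}" using g_fun_surj[of y] by auto
  show "0 < g_inv y"
    using the_inv_into_into[OF g_fun_inj_on y, of "{0<..}"] by (simp add: g_inv_def)
  show "ln (g_inv y) + g_inv y = y"
    using f_the_inv_into_f[OF g_fun_inj_on y] by (simp add: g_inv_def g_fun_def)
qed

text \<open>Exponentiating \<open>ln s + s = y\<close> gives \<open>s * exp s = exp y\<close>.
  Conversely, a solution must be positive since \<open>exp y\<close> is, so logarithms can be taken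
  and injectivity of \<open>g_fun\<close> applies.\<close>

lemma lambert_W_exp: "lambert_W (exp y) = g_inv y"
  unfolding lambert_W_def
proof (rule the_equality)
  have "exp y = exp (ln (g_inv y) + g_inv y)" by (simp add: g_fun_g_inv)
  also have "\<dots> = g_inv y * exp (g_inv y)" using g_inv_pos[of y] by (simp add: exp_add)
  finally show "- 1 \<le> g_inv y \<and> g_inv y * exp (g_inv y) = exp y"
    using g_inv_pos[of y] by simp
next
  fix w :: real assume w: "- 1 \<le> w \<and> w * exp w = exp y"
  hence "0 < w * exp w" by simp
  hence pos: "0 < w" by (simp add: zero_less_mult_iff)
  have "ln (w * exp w) = y" using w by simp
  hence "g_fun w = g_fun (g_inv y)"
    using pos g_fun_g_inv[of y] by (simp add: g_fun_def ln_mult)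
  thus "w = g_inv y"
    using g_fun_inj_on pos g_inv_pos[of y] by (auto simp: inj_on_def)
qed

section \<open>The proximal mapping\<close>

theorem lemma3p3:
  fixes \<rho>\<^sub>0 \<sigma> :: "complex^'n^'n" and \<tau> :: real
  assumes "psd \<rho>\<^sub>0" and "rank \<rho>\<^sub>0 = CARD('n)"
    and "\<tau> > 0"
    and "\<sigma> \<in> Herm"
  shows "prox \<tau> (\<lambda>\<rho>. QKL \<rho> \<rho>\<^sub>0) \<sigma> =
           {\<tau> *\<^sub>R spectral_fun g_inv ((1 / \<tau>) *\<^sub>R \<sigma> + spectral_fun ln \<rho>\<^sub>0 - mat (complex_of_real (ln \<tau>)))}
         \<and> \<tau> *\<^sub>R spectral_fun g_inv ((1 / \<tau>) *\<^sub>R \<sigma> + spectral_fun ln \<rho>\<^sub>0 - mat (complex_of_real (ln \<tau>))) =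
           \<tau> *\<^sub>R spectral_fun lambert_W ((1 / \<tau>) *\<^sub>R spectral_fun exp ((1 / \<tau>) *\<^sub>R \<sigma> + spectral_fun ln \<rho>\<^sub>0))"
proof -
  define L where "L = spectral_fun ln \<rho>\<^sub>0"
  define H where "H = (1 / \<tau>) *\<^sub>R \<sigma> + L"
  have "\<rho>\<^sub>0 \<in> Herm" using assms(1) by (simp add: psd_def)
  hence "H \<in> Herm"
    unfolding H_def L_def using assms(4) by (intro Herm_add Herm_scaleR spectral_fun_in_Herm)
  \<comment> \<open>\<sigma> and \<open>\<rho>\<^sub>0\<close> need not commute, but the candidate
    minimiser is a function of \<open>H\<close> alone, so an eigenbasis of \<open>H\<close> reduces
    its properties to scalar identities.\<close>
  then obtain U h where U: "unitary_mat U" and H: "H = U ** real_diag h ** ctranspose U"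
    using spectral_theorem by blast
  define m where "m i = h i - ln \<tau>" for i
  have M: "H - mat (complex_of_real (ln \<tau>)) = U ** real_diag m ** ctranspose U"
    unfolding mat_eq_real_diag_conj[OF U] H diff_eq_eq real_diag_conj_add by (simp add: m_def)
  define t where "t i = \<tau> * g_inv (m i)" for i
  have t_pos: "0 < t i" for i using assms(3) g_inv_pos by (simp add: t_def)
  define R where "R = \<tau> *\<^sub>R spectral_fun g_inv (H - mat (complex_of_real (ln \<tau>)))"
  have R: "R = U ** real_diag t ** ctranspose U"
    unfolding R_def M spectral_fun_real_diag_conj[OF U] real_diag_conj_scaleR t_def ..
  have R_psd: "psd R" unfolding R psd_real_diag_conj_iff[OF U] using t_pos by (simp add: less_imp_le)
  hence R_Herm: "R \<in> Herm" by (simp add: psd_def)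
  have lambert: "R = \<tau> *\<^sub>R spectral_fun lambert_W ((1 / \<tau>) *\<^sub>R spectral_fun exp H)"
  proof -
    have "(1 / \<tau>) * exp (h i) = exp (m i)" for i
      using assms(3) by (simp add: m_def exp_diff)
    thus ?thesis
      unfolding R_def M unfolding H
      by (simp only: spectral_fun_real_diag_conj[OF U] real_diag_conj_scaleR lambert_W_exp)
  qed
  have ln_R: "spectral_fun ln R = L + (1 / \<tau>) *\<^sub>R (\<sigma> - R)"
  proof -
    \<comment> \<open>Since \<open>t i\<close> is \<tau> times \<open>g_inv (m i)\<close>, the left
      side is \<open>ln \<tau> + m i\<close>; the shift in \<open>m\<close> was made to cancel this
      \<open>ln \<tau>\<close>.\<close>
    have "ln (t i) + (1 / \<tau>) * t i = h i" for i
      using assms(3) g_inv_pos[of "m i"] g_fun_g_inv[of "m i"]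
      by (simp add: t_def m_def ln_mult)
    hence "spectral_fun ln R + (1 / \<tau>) *\<^sub>R R = H"
      unfolding R H spectral_fun_real_diag_conj[OF U] real_diag_conj_scaleR real_diag_conj_add by simp
    thus ?thesis by (simp add: H_def algebra_simps)
  qed
  \<comment> \<open>This puts the entropy term of \<open>R\<close> in the form of a product trace,
    so the formula for \<open>ln R\<close> can be substituted into \<open>\<Phi> R\<close>.\<close>
  have R_ln_R: "spectral_fun (\<lambda>t. t * ln t) R = R ** spectral_fun ln R"
    unfolding R spectral_fun_real_diag_conj[OF U] real_diag_conj_mult[OF U] ..

  let ?F = "\<lambda>\<rho>. QKL \<rho> \<rho>\<^sub>0 + ereal (1 / (2 * \<tau>) * (hs_norm (\<rho> - \<sigma>))\<^sup>2)"
  \<comment> \<open>The finite values of the objective as a real function, so that comparisons on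
    the positive semidefinite matrices avoid extended reals.\<close>
  define \<Phi> where "\<Phi> \<rho> = Re (trace \<rho>\<^sub>0) - Re (trace \<rho>) + Re (trace (spectral_fun (\<lambda>t. t * ln t) \<rho>))
      - Re (trace (\<rho> ** L)) + 1 / (2 * \<tau>) * (hs_norm (\<rho> - \<sigma>))\<^sup>2" for \<rho>
  have F: "?F \<rho> = ereal (\<Phi> \<rho>)" if "psd \<rho>" for \<rho>
    using that by (simp add: QKL_def \<Phi>_def L_def trace_add trace_sub)
  have F_inf: "?F \<rho> = \<infinity>" if "\<not> psd \<rho>" for \<rho>
    using that by (simp add: QKL_def)
  have gap: "\<Phi> \<rho> \<ge> \<Phi> R + 1 / (2 * \<tau>) * (hs_norm (\<rho> - R))\<^sup>2" if "psd \<rho>" for \<rho>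
  proof -
    have \<rho>: "\<rho> \<in> Herm" using that by (simp add: psd_def)
    have "\<Phi> \<rho> - \<Phi> R - 1 / (2 * \<tau>) * (hs_norm (\<rho> - R))\<^sup>2 =
      Re (trace (spectral_fun (\<lambda>s. s * ln s) \<rho>)) - Re (trace (\<rho> ** spectral_fun ln R))
            - Re (trace \<rho>) + Re (trace R)"
      \<comment> \<open>After \<open>ln R\<close> is replaced by
        \<open>L + (1 / \<tau>) *\<^sub>R (\<sigma> - R)\<close>, everything is a combination of
        traces of products; cyclicity identifies the two orders of each mixed product and the
        quadratic terms cancel.\<close>
      using assms(3)
      by (simp add: \<Phi>_def hs_norm_square[OF Herm_diff] \<rho> R_Herm assms(4) R_ln_R ln_R
          Re_trace_mult_add_right Re_trace_mult_diff_right Re_trace_mult_scaleR_right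
          Re_trace_mult_diff_left trace_mul_sym[of R \<rho>] trace_mul_sym[of \<sigma> \<rho>] trace_mul_sym[of R \<sigma>]
          field_simps)
    also have "\<dots> \<ge> 0"
      using Klein_inequality[OF U t_pos that] unfolding R .
    finally show ?thesis by simp
  qed
  have "prox \<tau> (\<lambda>\<rho>. QKL \<rho> \<rho>\<^sub>0) \<sigma> = {R}"
  proof (intro equalityI subsetI)
    fix \<rho> assume "\<rho> \<in> prox \<tau> (\<lambda>\<rho>. QKL \<rho> \<rho>\<^sub>0) \<sigma>"
    hence \<rho>: "\<rho> \<in> Herm" and "\<not> ?F R < ?F \<rho>"
      using R_Herm by (auto simp: prox_def is_arg_min_def)
    hence le: "?F \<rho> \<le> ereal (\<Phi> R)" using F[OF R_psd] by (simp add: not_less)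
    \<comment> \<open>The value at \<open>R\<close> is finite, so a minimiser cannot lie where the
      objective is infinite.\<close>
    hence psd: "psd \<rho>" using F_inf by fastforce
    hence "\<Phi> \<rho> \<le> \<Phi> R" using le F by simp
    hence "1 / (2 * \<tau>) * (hs_norm (\<rho> - R))\<^sup>2 \<le> 0" using gap[OF psd] by linarith
    hence "hs_norm (\<rho> - R) = 0" using assms(3) by (simp add: mult_le_0_iff divide_le_0_iff)
    hence "\<rho> - R = 0" by (rule hs_norm_eq_0[OF Herm_diff[OF \<rho> R_Herm]])
    thus "\<rho> \<in> {R}" by simp
  next
    fix \<rho> assume "\<rho> \<in> {R}"
    moreover have "\<not> ?F \<rho>' < ?F R" for \<rho>'
    proof (cases "psd \<rho>'")
      case True
      have "0 \<le> 1 / (2 * \<tau>) * (hs_norm (\<rho>' - R))\<^sup>2" using assms(3) by simp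
      hence "\<Phi> R \<le> \<Phi> \<rho>'" using gap[OF True] by linarith
      thus ?thesis using F[OF True] F[OF R_psd] by simp
    next
      case False
      show ?thesis unfolding F_inf[OF False] by simp
    qed
    ultimately show "\<rho> \<in> prox \<tau> (\<lambda>\<rho>. QKL \<rho> \<rho>\<^sub>0) \<sigma>"
      using R_Herm by (auto simp: prox_def is_arg_min_def)
  qed
  thus ?thesis using lambert unfolding R_def H_def L_def by blast
qed

end
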